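(* Let $d=1$. Assume that the distribution of $R_1$ has a probability density $p$ on $(0,\infty)$ such that, for some constants $c>0$ and $\alpha>0$, $p(z)\le c\,z^{\alpha-1}$ for all sufficiently small $z>0$. Then $$D^{(q)}(r)\le\exp\Big(-\sqrt{(1+\alpha)\,r\log r}\cdot(1+o(1))\Big),\qquad r\to\infty.$$
   Context: Setting: $d=1$, balls are closed intervals $B(x,r)=[x-r,x+r]$. Let $(\xi_i)_{i\ge1}$ be i.i.d. uniform on $[0,1]$, $(R_i)_{i\ge1}$ i.i.d. positive random variables, $N$ a Poisson random variable with parameter $\lambda>0$; the families $(\xi_i)$, $(R_i)$ and $N$ are independent. Define the random set $S:=\bigcup_{i=1}^N B(\xi_i,R_i)\cap[0,1]$. Let $d_H$ be the Hausdorff distance between closed subsets of $\mathbb{R}$ (with respect to $|\cdot|$), with the convention $d_H(\emptyset,\emptyset)=0$ and $d_H(\emptyset,A)=+\infty$ for $A\ne\emptyset$. The quantization error is $$D^{(q)}(r):=\inf_{\#\mathcal{C}\le e^r}\mathbb{E}\min_{A\in\mathcal{C}}d_H(S,A),\qquad r>0,$$ where the infimum is over finite nonempty collections (codebooks) $\mathcal{C}$ of closed subsets of $\mathbb{R}$ (the empty set is allowed as an element) with at most $e^r$ elements. Notation: $f(r)\le\exp(-g(r)(1+o(1)))$ means there is a function $\varepsilon(r)\to0$ as $r\to\infty$ with $f(r)\le\exp(-g(r)(1+\varepsilon(r)))$ for all large $r$. *)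

theory Defs
  imports "HOL-Probability.Probability"
begin

text \<open>
  The extended-valued Hausdorff distance. As the infimum over the empty set is
  \<open>\<infinity>\<close> and the supremum over the empty set is \<open>0\<close> in \<^typ>\<open>ennreal\<close>,
  the conventions for the empty set come out as in the lemmas below.
\<close>

definition hausdorff_edist :: "'a::metric_space set \<Rightarrow> 'a set \<Rightarrow> ennreal" where
  "hausdorff_edist A B =
     max (SUP a\<in>A. INF b\<in>B. ennreal (dist a b)) (SUP b\<in>B. INF a\<in>A. ennreal (dist a b))"

lemma hausdorff_edist_empty_empty [simp]: "hausdorff_edist {} {} = 0"
  by (simp add: hausdorff_edist_def bot_ennreal)

lemma hausdorff_edist_empty_left [simp]: "A \<noteq> {} \<Longrightarrow> hausdorff_edist {} A = \<infinity>"
  by (simp add: hausdorff_edist_def)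

lemma hausdorff_edist_empty_right [simp]: "A \<noteq> {} \<Longrightarrow> hausdorff_edist A {} = \<infinity>"
  by (simp add: hausdorff_edist_def)

definition codebooks :: "real \<Rightarrow> real set set set" where
  "codebooks r = {\<C>. finite \<C> \<and> \<C> \<noteq> {} \<and> (\<forall>A\<in>\<C>. closed A) \<and> real (card \<C>) \<le> exp r}"

definition quantization_error :: "'a measure \<Rightarrow> ('a \<Rightarrow> real set) \<Rightarrow> real \<Rightarrow> ennreal" where
  "quantization_error M S r =
     (INF \<C>\<in>codebooks r. \<integral>\<^sup>+\<omega>. Min ((\<lambda>A. hausdorff_edist (S \<omega>) A) ` \<C>) \<partial>M)"

definition boolean_set ::
    "(nat \<Rightarrow> 'a \<Rightarrow> real) \<Rightarrow> (nat \<Rightarrow> 'a \<Rightarrow> real) \<Rightarrow> ('a \<Rightarrow> nat) \<Rightarrow> 'a \<Rightarrow> real set" where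
  "boolean_set \<xi> R N \<omega> = (\<Union>i<N \<omega>. cball (\<xi> i \<omega>) (R i \<omega>)) \<inter> {0..1}"

text \<open>
  Sequences are indexed from \<open>0\<close>. Mutual independence of all the variables
  \<open>\<xi> i\<close>, \<open>R i\<close> and \<open>N\<close> is stated for one family indexed by a sum type; since
  \<open>indep_vars\<close> needs a common value type, \<open>N\<close> is embedded into the reals there.
\<close>

locale boolean_model = prob_space M for M :: "'a measure" +
  fixes \<xi> R :: "nat \<Rightarrow> 'a \<Rightarrow> real" and N :: "'a \<Rightarrow> nat" and lam :: real
  assumes lam_pos: "lam > 0"
    and xi_measurable: "\<And>i. random_variable borel (\<xi> i)"
    and xi_uniform: "\<And>i. distr M borel (\<xi> i) = uniform_measure lborel {0..1}"
    and R_measurable: "\<And>i. random_variable borel (R i)"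
    and R_identically_distributed: "\<And>i. distr M borel (R i) = distr M borel (R 0)"
    and R_pos: "\<And>i. AE \<omega> in M. R i \<omega> > 0"
    and N_measurable: "random_variable (count_space UNIV) N"
    and N_poisson: "distr M (count_space UNIV) N = measure_pmf (poisson_pmf lam)"
    and independent:
      "indep_vars (\<lambda>_. borel)
         (\<lambda>k. case k of Inl i \<Rightarrow> \<xi> i | Inr (Inl i) \<Rightarrow> R i | Inr (Inr ()) \<Rightarrow> (\<lambda>\<omega>. real (N \<omega>)))
         (UNIV :: (nat + nat + unit) set)"

end

theory Submission
  imports Defs "HOL-Real_Asymp.Real_Asymp"
begin

text \<open>
  Fix a cell width \<open>1/m\<close>. Balls of radius above \<open>1/m\<close> whose centres lie in the same cell all contain
  that cell, so together they cover one interval. If \<open>k\<close> balls have radius at most \<open>1/m\<close>, the random set is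
  therefore a union of at most \<open>k + m + 1\<close> intervals
  (\<open>union_of_balls_as_interval_union\<close>), and rounding end points to a grid of mesh \<open>1/g\<close> gives about
  \<open>g ^ (2 * (k + m + 1))\<close> codewords with error \<open>1/g\<close> (\<open>grid_code_approximates\<close>).
  Many small balls are unlikely for two reasons: the Poisson number of balls contributes the
  factor \<open>1/k!\<close>, and the density condition makes each of them small with probability
  \<open>O(m powr -\<alpha>)\<close>. Hence (\<open>emeasure_many_small_le\<close>) the probability \<open>p k\<close> of at least \<open>k\<close> small
  balls is at most \<open>(const * m powr -\<alpha>) ^ k / k!\<close>, roughly
  \<open>exp (- (1 + \<alpha>) * k * ln k)\<close> when \<open>k\<close> and \<open>m\<close> are of comparable logarithmic size.

  The resolution is adapted to the probability. To reach a mean error of order \<open>exp (-L)\<close>, the sets with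
  \<open>k\<close> small balls only need error \<open>exp (-L) / p k\<close>, that is \<open>g k \<approx> p k * exp L\<close>. The logarithm of the
  number of codewords at level \<open>k\<close> is then about \<open>2 * k * (L - (1 + \<alpha>) * k * ln r / 2)\<close>, because the
  levels that matter have \<open>ln k \<approx> ln r / 2\<close>. Maximising this parabola over \<open>k\<close> gives
  \<open>L\<^sup>2 / ((1 + \<alpha>) * ln r)\<close>, and equating it with \<open>r\<close> yields \<open>L = sqrt ((1 + \<alpha>) * r * ln r)\<close>.
  A grid of fixed resolution for all levels would lose a factor of two in the exponent.

  To make this rigorous, a relative loss \<open>\<eta>\<close> is granted in \<open>L\<close>. The number of cells is
  \<open>m \<approx> r powr (1/2 - \<eta>/8)\<close>, small enough that the \<open>m\<close> large intervals cost only \<open>o(r)\<close> nats and large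
  enough that \<open>ln m \<approx> ln r / 2\<close>. Levels above \<open>sqrt r\<close> are too unlikely to need coding. The estimates
  are in \<open>level_cost\<close> and \<open>eventually_parameters\<close>; since \<open>\<eta>\<close> is arbitrary,
  \<open>exp_bound_with_vanishing_error\<close> turns them into a single error term that tends to zero.
\<close>

section \<open>Approximating unions of intervals\<close>

lemma hausdorff_edist_le:
  assumes "\<And>a. a \<in> A \<Longrightarrow> \<exists>b\<in>B. dist a b \<le> e" "\<And>b. b \<in> B \<Longrightarrow> \<exists>a\<in>A. dist a b \<le> e"
  shows "hausdorff_edist A B \<le> ennreal e"
  unfolding hausdorff_edist_def
proof (intro max.boundedI SUP_least)
  fix a assume "a \<in> A"
  then obtain b where "b \<in> B" "dist a b \<le> e" using assms by blast
  then show "(INF b\<in>B. ennreal (dist a b)) \<le> ennreal e"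
    by (intro INF_lower2[of b]) (auto intro: ennreal_leI)
next
  fix b assume "b \<in> B"
  then obtain a where "a \<in> A" "dist a b \<le> e" using assms by blast
  then show "(INF a\<in>A. ennreal (dist a b)) \<le> ennreal e"
    by (intro INF_lower2[of a]) (auto intro: ennreal_leI)
qed

definition interval_union :: "(real \<times> real) set \<Rightarrow> real set" where
  "interval_union P = (\<Union>(a, b)\<in>P. {a..b})"

definition grid :: "nat \<Rightarrow> real set" where
  "grid g = (\<lambda>i. real i / real g) ` {..g}"

text \<open>
  A codeword is listed by a sequence of exactly \<open>j\<close> pairs of grid points. Repetitions are allowed, so
  it also covers unions of fewer intervals, and the number of codewords is bounded by a plain power.
\<close>

definition grid_code :: "nat \<Rightarrow> nat \<Rightarrow> real set set" where
  "grid_code j g = (\<lambda>xs. interval_union (set xs)) ` {xs. set xs \<subseteq> grid g \<times> grid g \<and> length xs = j}"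

lemma finite_grid: "finite (grid g)"
  by (simp add: grid_def)

lemma finite_grid_code: "finite (grid_code j g)"
  unfolding grid_code_def
  by (intro finite_imageI finite_lists_length_eq finite_cartesian_product finite_grid)

lemma closed_grid_code: "A \<in> grid_code j g \<Longrightarrow> closed A"
  by (auto simp: grid_code_def interval_union_def)

lemma card_grid_code: "card (grid_code j g) \<le> (g + 1) ^ (2 * j)"
proof -
  have "card (grid g) \<le> g + 1"
    unfolding grid_def using card_image_le[of "{..g}" "\<lambda>i. real i / real g"] by simp
  then have "card (grid g \<times> grid g) \<le> (g + 1) ^ 2"
    by (simp only: card_cartesian_product power2_eq_square mult_le_mono)
  moreover have "card (grid_code j g) \<le> card (grid g \<times> grid g) ^ j"
    unfolding grid_code_def using finite_grid
    by (subst card_lists_length_eq[symmetric]) (auto intro!: card_image_le finite_lists_length_eq)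
  ultimately show ?thesis
    by (metis (no_types) le_trans power_mono power_mult zero_le)
qed

text \<open>
  Rounding down is monotone, so it maps a point of \<open>{a..b}\<close> into the interval between the rounded
  end points; conversely a point \<open>y\<close> of the rounded interval can lie outside \<open>{a..b}\<close> only just
  to the left of \<open>a\<close>, and is then close to \<open>a\<close>.
\<close>

lemma grid_code_approximates:
  assumes "finite P" "P \<noteq> {}" "card P \<le> j" "g > 0"
    and P: "\<And>a b. (a, b) \<in> P \<Longrightarrow> 0 \<le> a \<and> a \<le> b \<and> b \<le> 1"
  shows "\<exists>A\<in>grid_code j g. hausdorff_edist (interval_union P) A \<le> ennreal (1 / real g)"
proof -
  define rd where "rd x = real (nat \<lfloor>real g * x\<rfloor>) / real g" for x
  have rd_mono: "rd x \<le> rd y" if "x \<le> y" for x y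
    unfolding rd_def using that \<open>g > 0\<close>
    by (intro divide_right_mono of_nat_mono nat_mono floor_mono mult_left_mono) auto
  have rd_le: "rd x \<le> x" and rd_gt: "x \<le> rd x + 1 / real g" if "0 \<le> x" for x
  proof -
    have "real g * x \<ge> 0" using that by simp
    then have *: "real (nat \<lfloor>real g * x\<rfloor>) \<le> real g * x \<and> real g * x \<le> real (nat \<lfloor>real g * x\<rfloor>) + 1"
      by linarith
    show "rd x \<le> x" using * \<open>g > 0\<close> by (simp add: rd_def field_simps)
    have "x = (real g * x) / real g" using \<open>g > 0\<close> by simp
    also have "\<dots> \<le> (real (nat \<lfloor>real g * x\<rfloor>) + 1) / real g"
      by (rule divide_right_mono) (use * in auto)
    finally show "x \<le> rd x + 1 / real g" by (simp add: rd_def add_divide_distrib)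
  qed
  have rd_grid: "rd x \<in> grid g" if "0 \<le> x" "x \<le> 1" for x
  proof -
    have "real g * x \<le> real g" using that by (simp add: mult_left_le)
    then have "nat \<lfloor>real g * x\<rfloor> \<le> g" by linarith
    then show ?thesis by (auto simp: rd_def grid_def)
  qed
  obtain xs where xs: "set xs = P" "length xs = card P"
    using \<open>finite P\<close> by (metis distinct_card finite_distinct_list)
  \<comment> \<open>Repeating one interval brings the list to the prescribed length \<open>j\<close>.\<close>
  define ys where "ys = map (map_prod rd rd) (xs @ replicate (j - card P) (hd xs))"
  have "xs \<noteq> []" using xs \<open>P \<noteq> {}\<close> by auto
  then have set_ys: "set ys = map_prod rd rd ` P"
    using xs(1) by (auto simp: ys_def image_iff)
  have "length ys = j" using xs \<open>card P \<le> j\<close> by (simp add: ys_def)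
  moreover have "set ys \<subseteq> grid g \<times> grid g"
    unfolding set_ys using P by (fastforce intro!: rd_grid)
  ultimately have "interval_union (set ys) \<in> grid_code j g"
    by (auto simp: grid_code_def)
  moreover have "hausdorff_edist (interval_union P) (interval_union (set ys)) \<le> ennreal (1 / real g)"
  proof (rule hausdorff_edist_le)
    fix x assume "x \<in> interval_union P"
    then obtain a b where ab: "(a, b) \<in> P" "a \<le> x" "x \<le> b" by (auto simp: interval_union_def)
    then have "rd x \<in> interval_union (set ys)"
      unfolding set_ys interval_union_def by (force intro: rd_mono)
    moreover have "dist x (rd x) \<le> 1 / real g"
      using rd_le[of x] rd_gt[of x] P[OF ab(1)] ab by (simp add: dist_real_def abs_if)
    ultimately show "\<exists>y\<in>interval_union (set ys). dist x y \<le> 1 / real g" by blast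
  next
    fix y assume "y \<in> interval_union (set ys)"
    then obtain a b where ab: "(a, b) \<in> P" "rd a \<le> y" "y \<le> rd b"
      by (auto simp: interval_union_def set_ys)
    have "max a y \<in> interval_union P"
      using ab P[OF ab(1)] rd_le[of b] unfolding interval_union_def by (intro UN_I[of "(a, b)"]) auto
    moreover have "dist (max a y) y \<le> 1 / real g"
      using ab P[OF ab(1)] rd_gt[of a] by (auto simp: dist_real_def max_def)
    ultimately show "\<exists>x\<in>interval_union P. dist x y \<le> 1 / real g" by blast
  qed
  ultimately show ?thesis by blast
qed

section \<open>A union of balls as a union of few intervals\<close>

lemma union_of_balls_with_common_point:
  fixes x r :: "'i \<Rightarrow> real"
  assumes "finite T" "T \<noteq> {}" "z \<in> {0..1}" and z: "\<And>i. i \<in> T \<Longrightarrow> z \<in> cball (x i) (r i)"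
  shows "\<exists>a b. 0 \<le> a \<and> a \<le> b \<and> b \<le> 1 \<and> (\<Union>i\<in>T. cball (x i) (r i)) \<inter> {0..1} = {a..b}"
proof -
  let ?U = "\<Union>i\<in>T. cball (x i) (r i) \<inter> {0..1}"
  have "connected ?U"
  proof (rule connected_Union)
    show "\<And>s. s \<in> (\<lambda>i. cball (x i) (r i) \<inter> {0..1}) ` T \<Longrightarrow> connected s"
      by (auto simp: convex_Int convex_connected)
    show "\<Inter> ((\<lambda>i. cball (x i) (r i) \<inter> {0..1}) ` T) \<noteq> {}"
      using z \<open>z \<in> {0..1}\<close> by blast
  qed
  moreover have "compact ?U" using \<open>finite T\<close> by (intro compact_UN) auto
  ultimately obtain a b where ab: "?U = {a..b}"
    using connected_compact_interval_1 by (metis box_real(2))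
  have "z \<in> ?U" using z assms by blast
  then have "a \<le> b" unfolding ab by simp
  then have "a \<in> ?U" "b \<in> ?U" unfolding ab by auto
  then show ?thesis using ab \<open>a \<le> b\<close> by (intro exI[of _ a] exI[of _ b]) auto
qed

text \<open>
  Each ball of radius at most \<open>1/m\<close> forms a group of its own; the other balls are grouped by the cell
  \<open>[l/m, (l+1)/m)\<close> of their centres and then share the point \<open>l/m\<close>. Every group covers one
  interval. The index \<open>l = m\<close> occurs for centres at \<open>1\<close>, which explains \<open>m + 1\<close> instead of \<open>m\<close>.
\<close>

lemma union_of_balls_as_interval_union:
  fixes x r :: "nat \<Rightarrow> real"
  assumes "n > 0" "m > 0" and x: "\<And>i. i < n \<Longrightarrow> x i \<in> {0..1}" and r: "\<And>i. i < n \<Longrightarrow> r i > 0"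
  shows "\<exists>P. finite P \<and> P \<noteq> {} \<and> card P \<le> card {i. i < n \<and> r i \<le> 1 / real m} + m + 1
    \<and> (\<forall>(a, b)\<in>P. 0 \<le> a \<and> a \<le> b \<and> b \<le> 1)
    \<and> (\<Union>i<n. cball (x i) (r i)) \<inter> {0..1} = interval_union P"
proof -
  define lab :: "nat \<Rightarrow> nat + nat" where
    "lab i = (if r i \<le> 1 / real m then Inl i else Inr (nat \<lfloor>real m * x i\<rfloor>))" for i
  define fib where "fib l = {i. i < n \<and> lab i = l}" for l
  define W where "W = lab ` {..<n}"
  have floor_le: "nat \<lfloor>real m * x i\<rfloor> \<le> m" if "i < n" for i
  proof -
    have "real m * x i \<le> real m" using x[OF that] by (simp add: mult_left_le)
    then show ?thesis by linarith
  qed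
  have "\<exists>a b. 0 \<le> a \<and> a \<le> b \<and> b \<le> 1 \<and> (\<Union>i\<in>fib l. cball (x i) (r i)) \<inter> {0..1} = {a..b}"
    if "l \<in> W" for l
  proof -
    from that obtain i0 where i0: "i0 < n" "lab i0 = l" by (auto simp: W_def)
    define z where "z = (case l of Inl i \<Rightarrow> x i | Inr c \<Rightarrow> real c / real m)"
    show ?thesis
    proof (rule union_of_balls_with_common_point)
      show "finite (fib l)" "fib l \<noteq> {}" using i0 by (auto simp: fib_def)
      show "z \<in> {0..1}"
        using i0 x[OF i0(1)] floor_le[OF i0(1)] \<open>m > 0\<close> by (auto simp: z_def lab_def split: if_splits)
      show "z \<in> cball (x i) (r i)" if "i \<in> fib l" for i
      proof (cases "r i \<le> 1 / real m")
        case True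
        with that r[of i] show ?thesis by (auto simp: fib_def lab_def z_def)
      next
        case False
        then have l: "l = Inr (nat \<lfloor>real m * x i\<rfloor>)" and "i < n" using that by (auto simp: fib_def lab_def)
        have "x i \<ge> 0" using x[OF \<open>i < n\<close>] by simp
        then have "\<bar>real m * x i - real (nat \<lfloor>real m * x i\<rfloor>)\<bar> \<le> 1" by (simp add: of_nat_nat) linarith
        then have "\<bar>real m * x i - real (nat \<lfloor>real m * x i\<rfloor>)\<bar> / real m \<le> 1 / real m"
          by (rule divide_right_mono) simp
        moreover have "\<bar>real m * x i - real (nat \<lfloor>real m * x i\<rfloor>)\<bar> / real m = dist (x i) z"
          using \<open>m > 0\<close> by (subst abs_div_pos) (simp_all add: z_def l dist_real_def diff_divide_distrib)
        ultimately show ?thesis using False by simp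
      qed
    qed
  qed
  then obtain a b where ab: "\<And>l. l \<in> W \<Longrightarrow> 0 \<le> a l \<and> a l \<le> b l \<and> b l \<le> 1 \<and>
      (\<Union>i\<in>fib l. cball (x i) (r i)) \<inter> {0..1} = {a l..b l}"
    by metis
  define P where "P = (\<lambda>l. (a l, b l)) ` W"
  have "finite W" "W \<noteq> {}" using \<open>n > 0\<close> by (auto simp: W_def)
  have "W \<subseteq> Inl ` {i. i < n \<and> r i \<le> 1 / real m} \<union> Inr ` {..m}"
    using floor_le by (auto simp: W_def lab_def)
  then have "card W \<le> card (Inl ` {i. i < n \<and> r i \<le> 1 / real m} \<union> Inr ` {..m} :: (nat + nat) set)"
    by (intro card_mono) auto
  also have "\<dots> \<le> card {i. i < n \<and> r i \<le> 1 / real m} + (m + 1)"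
    by (rule order_trans[OF card_Un_le]) (simp add: card_image)
  finally have "card P \<le> card {i. i < n \<and> r i \<le> 1 / real m} + m + 1"
    unfolding P_def using card_image_le[OF \<open>finite W\<close>, of "\<lambda>l. (a l, b l)"] by simp
  moreover have "(\<Union>i<n. cball (x i) (r i)) \<inter> {0..1} = (\<Union>l\<in>W. (\<Union>i\<in>fib l. cball (x i) (r i)) \<inter> {0..1})"
    by (auto simp: W_def fib_def)
  then have "(\<Union>i<n. cball (x i) (r i)) \<inter> {0..1} = interval_union P"
    using ab by (simp add: P_def interval_union_def)
  moreover have "\<forall>(a, b)\<in>P. 0 \<le> a \<and> a \<le> b \<and> b \<le> 1" using ab by (auto simp: P_def)
  ultimately show ?thesis
    using \<open>finite W\<close> \<open>W \<noteq> {}\<close> by (intro exI[of _ P]) (auto simp: P_def)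
qed

section \<open>Few balls are small\<close>

text \<open>
  The binomial moments of the Poisson distribution: \<open>n choose k\<close> cancels against \<open>n!\<close> and leaves
  \<open>lam ^ k / k!\<close> times a shifted Poisson distribution of total mass one.
\<close>

lemma sums_poisson_binomial_moment:
  fixes lam :: real
  assumes "lam > 0"
  shows "(\<lambda>n. pmf (poisson_pmf lam) n * real (n choose k)) sums (lam ^ k / fact k)"
proof -
  let ?f = "\<lambda>n. pmf (poisson_pmf lam) n * real (n choose k)"
  have "?f (j + k) = (exp (- lam) * lam ^ k / fact k) * (lam ^ j / fact j)" for j
    using assms by (simp add: binomial_fact power_add)
  moreover have "(\<lambda>j. (exp (- lam) * lam ^ k / fact k) * (lam ^ j / fact j)) sums
      ((exp (- lam) * lam ^ k / fact k) * exp lam)"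
    using exp_converges[of lam] by (intro sums_mult) (simp add: divide_inverse mult.commute)
  moreover have "(exp (- lam) * lam ^ k / fact k) * exp lam = lam ^ k / fact k"
    by (simp add: exp_minus)
  ultimately have "(\<lambda>j. ?f (j + k)) sums (lam ^ k / fact k)" by (simp only:)
  moreover have "(\<Sum>i<k. ?f i) = 0"
    by (intro sum.neutral) (auto simp: binomial_eq_0)
  ultimately show ?thesis
    using sums_iff_shift[of ?f k "lam ^ k / fact k"] by (simp only: add_0_right)
qed

context boolean_model
begin

definition small :: "real \<Rightarrow> 'a \<Rightarrow> nat set" where
  "small \<rho> \<omega> = {i. i < N \<omega> \<and> R i \<omega> \<le> \<rho>}"

definition many_small :: "real \<Rightarrow> nat \<Rightarrow> 'a set" where
  "many_small \<rho> k = {\<omega> \<in> space M. k \<le> card (small \<rho> \<omega>)}"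

lemma prob_all_small:
  assumes "finite T"
  shows "prob {\<omega> \<in> space M. N \<omega> = n \<and> (\<forall>i\<in>T. R i \<omega> \<le> \<rho>)}
    = pmf (poisson_pmf lam) n * prob {\<omega> \<in> space M. R 0 \<omega> \<le> \<rho>} ^ card T"
proof -
  define X :: "nat + nat + unit \<Rightarrow> 'a \<Rightarrow> real" where
    "X = (\<lambda>k. case k of Inl i \<Rightarrow> \<xi> i | Inr (Inl i) \<Rightarrow> R i | Inr (Inr ()) \<Rightarrow> (\<lambda>\<omega>. real (N \<omega>)))"
  define A :: "nat + nat + unit \<Rightarrow> real set" where
    "A k = (if k = Inr (Inr ()) then {real n} else {..\<rho>})" for k
  define e :: "nat \<Rightarrow> nat + nat + unit" where "e i = Inr (Inl i)" for i
  have X: "X (Inr (Inr ())) = (\<lambda>\<omega>. real (N \<omega>))" "X (e i) = R i" for i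
    by (simp_all add: X_def e_def split: unit.split)
  have A: "A (Inr (Inr ())) = {real n}" "A (e i) = {..\<rho>}" for i
    by (simp_all add: A_def e_def)
  have e: "inj_on e T" "Inr (Inr ()) \<notin> e ` T" by (auto simp: e_def inj_on_def)
  have "A k \<in> sets borel" for k by (simp add: A_def)
  then have "prob (\<Inter>k\<in>insert (Inr (Inr ())) (e ` T). X k -` A k \<inter> space M)
      = (\<Prod>k\<in>insert (Inr (Inr ())) (e ` T). prob (X k -` A k \<inter> space M))"
    using assms by (intro indep_varsD[OF independent[folded X_def]]) auto
  also have "\<dots> = prob ((\<lambda>\<omega>. real (N \<omega>)) -` {real n} \<inter> space M)
      * (\<Prod>i\<in>T. prob (R i -` {..\<rho>} \<inter> space M))"
    using assms e by (simp add: prod.reindex X A)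
  also have "(\<lambda>\<omega>. real (N \<omega>)) -` {real n} \<inter> space M = N -` {n} \<inter> space M" by auto
  also have "prob (N -` {n} \<inter> space M) = measure (distr M (count_space UNIV) N) {n}"
    using N_measurable by (subst measure_distr) auto
  also have "\<dots> = pmf (poisson_pmf lam) n" unfolding N_poisson by (simp add: pmf.rep_eq)
  also have "(\<Prod>i\<in>T. prob (R i -` {..\<rho>} \<inter> space M)) = prob {\<omega> \<in> space M. R 0 \<omega> \<le> \<rho>} ^ card T"
  proof -
    have "prob (R i -` {..\<rho>} \<inter> space M) = prob {\<omega> \<in> space M. R 0 \<omega> \<le> \<rho>}" for i
    proof -
      have "prob (R i -` {..\<rho>} \<inter> space M) = measure (distr M borel (R i)) {..\<rho>}"
        using R_measurable by (subst measure_distr) auto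
      also have "\<dots> = measure (distr M borel (R 0)) {..\<rho>}"
        by (simp only: R_identically_distributed[of i])
      also have "\<dots> = prob (R 0 -` {..\<rho>} \<inter> space M)"
        using R_measurable by (subst measure_distr) auto
      also have "R 0 -` {..\<rho>} \<inter> space M = {\<omega> \<in> space M. R 0 \<omega> \<le> \<rho>}" by auto
      finally show ?thesis .
    qed
    then show ?thesis by simp
  qed
  also have "(\<Inter>k\<in>insert (Inr (Inr ())) (e ` T). X k -` A k \<inter> space M)
      = {\<omega> \<in> space M. N \<omega> = n \<and> (\<forall>i\<in>T. R i \<omega> \<le> \<rho>)}"
    by (auto simp: X A)
  finally show ?thesis .
qed

text \<open>
  The events on the right fix the number of balls and constrain the radii of finitely many of them,
  so independence gives their probabilities exactly.
\<close>

lemma many_small_eq: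
  "many_small \<rho> k = (\<Union>n. \<Union>T\<in>{T. T \<subseteq> {..<n} \<and> card T = k}.
      {\<omega> \<in> space M. N \<omega> = n \<and> (\<forall>i\<in>T. R i \<omega> \<le> \<rho>)})"
proof (intro equalityI subsetI)
  fix \<omega> assume "\<omega> \<in> many_small \<rho> k"
  then have \<omega>: "\<omega> \<in> space M" "k \<le> card (small \<rho> \<omega>)" by (auto simp: many_small_def)
  then obtain T where T: "T \<subseteq> small \<rho> \<omega>" "card T = k" using obtain_subset_with_card_n by metis
  then have "T \<subseteq> {..<N \<omega>}" "\<forall>i\<in>T. R i \<omega> \<le> \<rho>" by (auto simp: small_def)
  with T \<omega> show "\<omega> \<in> (\<Union>n. \<Union>T\<in>{T. T \<subseteq> {..<n} \<and> card T = k}.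
      {\<omega> \<in> space M. N \<omega> = n \<and> (\<forall>i\<in>T. R i \<omega> \<le> \<rho>)})" by auto
next
  fix \<omega> assume "\<omega> \<in> (\<Union>n. \<Union>T\<in>{T. T \<subseteq> {..<n} \<and> card T = k}.
      {\<omega> \<in> space M. N \<omega> = n \<and> (\<forall>i\<in>T. R i \<omega> \<le> \<rho>)})"
  then obtain T where T: "T \<subseteq> small \<rho> \<omega>" "card T = k" "\<omega> \<in> space M"
    by (auto simp: small_def subset_iff)
  moreover have "finite (small \<rho> \<omega>)" by (simp add: small_def)
  ultimately show "\<omega> \<in> many_small \<rho> k" by (auto simp: many_small_def intro: card_mono)
qed

lemma finite_subsets_of_card: "finite {T. T \<subseteq> {..<n::nat} \<and> card T = k}"
  by (rule finite_subset[of _ "Pow {..<n}"]) auto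

lemma all_small_event:
  assumes "finite T"
  shows "{\<omega> \<in> space M. N \<omega> = n \<and> (\<forall>i\<in>T. R i \<omega> \<le> \<rho>)} \<in> events"
proof -
  note [measurable] = R_measurable N_measurable
  show ?thesis using assms by measurable
qed

lemma many_small_event: "many_small \<rho> k \<in> events"
  unfolding many_small_eq
  by (intro sets.countable_UN sets.finite_UN finite_subsets_of_card image_subsetI all_small_event)
    (auto intro: finite_subset)

text \<open>
  Union bound over all \<open>k\<close>-element sets of balls: given \<open>n\<close> balls there are \<open>n choose k\<close> of them, and
  averaging over the Poisson number of balls gives the binomial moment.
\<close>

lemma emeasure_many_small_le:
  "emeasure M (many_small \<rho> k) \<le> ennreal ((lam * prob {\<omega> \<in> space M. R 0 \<omega> \<le> \<rho>}) ^ k / fact k)"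
proof -
  define q where "q = prob {\<omega> \<in> space M. R 0 \<omega> \<le> \<rho>}"
  let ?T = "\<lambda>n. {T. T \<subseteq> {..<n} \<and> card T = k}"
  let ?E = "\<lambda>n T. {\<omega> \<in> space M. N \<omega> = n \<and> (\<forall>i\<in>T. R i \<omega> \<le> \<rho>)}"
  have E: "?E n T \<in> events" if "T \<in> ?T n" for n T
    using that by (auto intro!: all_small_event intro: finite_subset)
  have E': "emeasure M (?E n T) = ennreal (pmf (poisson_pmf lam) n * q ^ k)" if "T \<in> ?T n" for n T
    using that prob_all_small[of T n \<rho>] finite_subset[of T "{..<n}"]
    by (auto simp: emeasure_eq_measure q_def)
  have card_T: "card (?T n) = n choose k" for n
    using n_subsets[of "{..<n}" k] by simp
  have U: "(\<Union>T\<in>?T n. ?E n T) \<in> events" for n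
    using E by (intro sets.finite_UN finite_subsets_of_card) auto
  have "emeasure M (many_small \<rho> k) \<le> (\<Sum>n. emeasure M (\<Union>T\<in>?T n. ?E n T))"
    unfolding many_small_eq using U by (intro emeasure_subadditive_countably) auto
  also have "\<dots> \<le> (\<Sum>n. ennreal (pmf (poisson_pmf lam) n * real (n choose k) * q ^ k))"
  proof (intro suminf_le)
    fix n
    have "emeasure M (\<Union>T\<in>?T n. ?E n T) \<le> (\<Sum>T\<in>?T n. emeasure M (?E n T))"
      using E by (intro emeasure_subadditive_finite finite_subsets_of_card) auto
    also have "\<dots> = of_nat (n choose k) * ennreal (pmf (poisson_pmf lam) n * q ^ k)"
      using E' by (simp add: card_T)
    also have "\<dots> = ennreal (pmf (poisson_pmf lam) n * real (n choose k) * q ^ k)"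
      by (simp add: ennreal_of_nat_eq_real_of_nat ac_simps flip: ennreal_mult')
    finally show "emeasure M (\<Union>T\<in>?T n. ?E n T)
      \<le> ennreal (pmf (poisson_pmf lam) n * real (n choose k) * q ^ k)" .
  qed auto
  also have "\<dots> = ennreal ((lam * q) ^ k / fact k)"
  proof (rule suminf_ennreal_eq)
    show "(\<lambda>n. pmf (poisson_pmf lam) n * real (n choose k) * q ^ k) sums ((lam * q) ^ k / fact k)"
      using sums_mult2[OF sums_poisson_binomial_moment[OF lam_pos], of k "q ^ k"]
      by (simp add: power_mult_distrib)
  qed (simp add: q_def)
  finally show ?thesis by (simp add: q_def)
qed

section \<open>The codebook\<close>

lemma AE_centres_in_unit_interval: "AE \<omega> in M. \<xi> i \<omega> \<in> {0..1}"
proof -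
  have "AE x in distr M borel (\<xi> i). x \<in> {0..1}"
    unfolding xi_uniform by (rule AE_uniform_measureI) auto
  then show ?thesis using xi_measurable by (subst (asm) AE_distr_iff) auto
qed

text \<open>
  The codebook joins one grid code per number \<open>k \<le> n\<close> of small balls, each with its own resolution
  \<open>g k\<close>. The two further codewords avoid an infinite distance: \<open>{}\<close> encodes the empty set exactly, and
  \<open>{0}\<close> encodes every nonempty subset of \<open>{0..1}\<close> with error at most one, which is used when there are
  more than \<open>n\<close> small balls.
\<close>

lemma quantization_error_le:
  fixes g :: "nat \<Rightarrow> nat"
  assumes "m > 0" and g: "\<And>k. g k > 0"
    and q: "prob {\<omega> \<in> space M. R 0 \<omega> \<le> 1 / real m} \<le> q"
    and size: "2 + (\<Sum>k\<le>n. real (g k + 1) ^ (2 * (k + m + 1))) \<le> exp r"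
  shows "quantization_error M (boolean_set \<xi> R N) r
    \<le> ennreal ((\<Sum>k\<le>n. (lam * q) ^ k / fact k / real (g k)) + (lam * q) ^ Suc n / fact (Suc n))"
proof -
  let ?S = "boolean_set \<xi> R N"
  define \<C> where "\<C> = {{}, {0}} \<union> (\<Union>k\<le>n. grid_code (k + m + 1) (g k))"
  define E where "E = many_small (1 / real m)"
  define p where "p k = (lam * q) ^ k / fact k" for k
  have q0: "q \<ge> 0" by (rule order_trans[OF measure_nonneg q])
  have [simp]: "p k \<ge> 0" for k using q0 lam_pos by (simp add: p_def)
  have fin: "finite \<C>" unfolding \<C>_def by (auto intro: finite_grid_code)
  have "card \<C> \<le> 2 + (\<Sum>k\<le>n. card (grid_code (k + m + 1) (g k)))"
    unfolding \<C>_def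
    by (rule order_trans[OF card_Un_le], rule add_mono) (auto intro!: card_UN_le card_insert_le_m1)
  also have "\<dots> \<le> 2 + (\<Sum>k\<le>n. (g k + 1) ^ (2 * (k + m + 1)))"
    by (intro add_left_mono sum_mono card_grid_code)
  finally have "real (card \<C>) \<le> real (2 + (\<Sum>k\<le>n. (g k + 1) ^ (2 * (k + m + 1))))"
    by (rule of_nat_mono)
  also have "\<dots> = 2 + (\<Sum>k\<le>n. real (g k + 1) ^ (2 * (k + m + 1)))"
    by (simp only: of_nat_add of_nat_sum of_nat_power of_nat_numeral)
  finally have "\<C> \<in> codebooks r"
    unfolding codebooks_def using fin size by (auto simp: \<C>_def dest: closed_grid_code)
  then have "quantization_error M ?S r
      \<le> (\<integral>\<^sup>+\<omega>. Min ((\<lambda>A. hausdorff_edist (?S \<omega>) A) ` \<C>) \<partial>M)"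
    unfolding quantization_error_def by (rule INF_lower)
  also have "\<dots> \<le> (\<integral>\<^sup>+\<omega>. (\<Sum>k\<le>n. ennreal (1 / real (g k)) * indicator (E k) \<omega>)
      + indicator (E (Suc n)) \<omega> \<partial>M)"
  proof (rule nn_integral_mono_AE)
    have "AE \<omega> in M. \<forall>i. \<xi> i \<omega> \<in> {0..1}" "AE \<omega> in M. \<forall>i. R i \<omega> > 0"
      unfolding AE_all_countable using AE_centres_in_unit_interval R_pos by blast+
    then show "AE \<omega> in M. Min ((\<lambda>A. hausdorff_edist (?S \<omega>) A) ` \<C>)
        \<le> (\<Sum>k\<le>n. ennreal (1 / real (g k)) * indicator (E k) \<omega>) + indicator (E (Suc n)) \<omega>"
      using AE_space
    proof eventually_elim
      case (elim \<omega>)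
      define k where "k = card (small (1 / real m) \<omega>)"
      let ?h = "(\<Sum>k\<le>n. ennreal (1 / real (g k)) * indicator (E k) \<omega>)
        + indicator (E (Suc n)) \<omega> :: ennreal"
      have Min_le: "Min ((\<lambda>A. hausdorff_edist (?S \<omega>) A) ` \<C>) \<le> hausdorff_edist (?S \<omega>) A" if "A \<in> \<C>" for A
        using that fin by (intro Min_le) auto
      show ?case
      proof (cases "N \<omega> = 0")
        case True
        then have "?S \<omega> = {}" by (simp add: boolean_set_def)
        then show ?thesis using Min_le[of "{}"] by (simp add: \<C>_def)
      next
        case False
        with elim \<open>m > 0\<close> union_of_balls_as_interval_union[of "N \<omega>" m "\<lambda>i. \<xi> i \<omega>" "\<lambda>i. R i \<omega>"]
        obtain P where P: "finite P" "P \<noteq> {}" "card P \<le> k + m + 1" "?S \<omega> = interval_union P"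
          and P_bounds: "\<forall>(a, b)\<in>P. 0 \<le> a \<and> a \<le> b \<and> b \<le> 1"
          unfolding boolean_set_def k_def small_def by blast
        have P5: "0 \<le> a \<and> a \<le> b \<and> b \<le> 1" if "(a, b) \<in> P" for a b
          using P_bounds that by blast
        show ?thesis
        proof (cases "k \<le> n")
          case True
          obtain A where A: "A \<in> grid_code (k + m + 1) (g k)"
            "hausdorff_edist (?S \<omega>) A \<le> ennreal (1 / real (g k))"
            using grid_code_approximates[OF P(1-3) g P5] unfolding P(4) by blast
          have "A \<in> \<C>" using A True by (auto simp: \<C>_def)
          then have "Min ((\<lambda>A. hausdorff_edist (?S \<omega>) A) ` \<C>) \<le> ennreal (1 / real (g k))"
            using Min_le A(2) by (meson order_trans)
          also have "\<dots> = ennreal (1 / real (g k)) * indicator (E k) \<omega>"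
            using elim by (simp add: E_def many_small_def k_def)
          also have "\<dots> \<le> (\<Sum>k\<le>n. ennreal (1 / real (g k)) * indicator (E k) \<omega>)"
            using True by (intro member_le_sum) auto
          also have "\<dots> \<le> ?h" by simp
          finally show ?thesis .
        next
          case False
          obtain a b where ab: "(a, b) \<in> P" using P(2) by auto
          have S: "?S \<omega> \<subseteq> {0..1}" "a \<in> ?S \<omega>"
            using P5[OF ab] ab unfolding P(4) interval_union_def by (force dest: P5)+
          have "Min ((\<lambda>A. hausdorff_edist (?S \<omega>) A) ` \<C>) \<le> hausdorff_edist (?S \<omega>) {0}"
            by (rule Min_le) (simp add: \<C>_def)
          also have "\<dots> \<le> ennreal 1"
            using S by (intro hausdorff_edist_le) (auto simp: dist_real_def intro!: bexI[of _ a])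
          also have "\<dots> = indicator (E (Suc n)) \<omega>"
            using False elim by (simp add: E_def many_small_def k_def)
          also have "\<dots> \<le> ?h" by simp
          finally show ?thesis .
        qed
      qed
    qed
  qed
  also have "\<dots> = (\<Sum>k\<le>n. ennreal (1 / real (g k)) * emeasure M (E k)) + emeasure M (E (Suc n))"
  proof -
    have [measurable]: "E k \<in> events" for k using many_small_event by (simp add: E_def)
    have "(\<integral>\<^sup>+\<omega>. (\<Sum>k\<le>n. ennreal (1 / real (g k)) * indicator (E k) \<omega>) \<partial>M)
        = (\<Sum>k\<le>n. \<integral>\<^sup>+\<omega>. ennreal (1 / real (g k)) * indicator (E k) \<omega> \<partial>M)"
      by (rule nn_integral_sum) measurable
    then show ?thesis by (subst nn_integral_add) (measurable, simp add: nn_integral_cmult_indicator)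
  qed
  also have "\<dots> \<le> (\<Sum>k\<le>n. ennreal (1 / real (g k)) * ennreal (p k)) + ennreal (p (Suc n))"
  proof -
    have "emeasure M (E k) \<le> ennreal (p k)" for k
      unfolding E_def p_def using q lam_pos
      by (intro order_trans[OF emeasure_many_small_le] ennreal_leI divide_right_mono power_mono mult_left_mono) auto
    then show ?thesis by (intro add_mono sum_mono mult_left_mono) auto
  qed
  also have "\<dots> = ennreal ((\<Sum>k\<le>n. p k / real (g k)) + p (Suc n))"
    by (simp add: sum_nonneg flip: ennreal_mult)
  finally show ?thesis by (simp add: p_def)
qed

end

section \<open>Choosing the parameters\<close>

lemma power_div_fact_le_exp:
  fixes x :: real
  assumes "x \<ge> 0"
  shows "x ^ k / fact k \<le> exp x"
proof -
  have "(\<Sum>i\<in>{k}. x ^ i /\<^sub>R fact i) \<le> (\<Sum>i. x ^ i /\<^sub>R fact i)"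
    using assms summable_exp_generic[of x] by (intro sum_le_suminf) auto
  then show ?thesis by (simp add: exp_def divide_inverse mult.commute)
qed

text \<open>Stirling's bound \<open>k! \<ge> (k / e) ^ k\<close> in the form used here, with \<open>k\<close> replaced by a lower bound.\<close>

lemma tail_term_le:
  fixes x b :: real
  assumes "b \<ge> 0" "x > 0" "x \<le> real k"
  shows "b ^ k / fact k \<le> (b * exp 1 / x) ^ k"
proof -
  have "x ^ k \<le> real k ^ k" using assms by (intro power_mono) auto
  also have "\<dots> \<le> exp (real k) * fact k"
    using power_div_fact_le_exp[of "real k" k] by (simp add: field_simps)
  finally have "x ^ k / fact k \<le> exp 1 ^ k"
    by (simp add: field_simps flip: exp_of_nat_mult)
  then have "(b / x) ^ k * (x ^ k / fact k) \<le> (b / x) ^ k * exp 1 ^ k"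
    using assms by (intro mult_left_mono) auto
  then show ?thesis
    using assms by (simp add: power_mult_distrib power_divide)
qed

definition rate :: "real \<Rightarrow> real \<Rightarrow> real" where
  "rate \<alpha> r = sqrt ((1 + \<alpha>) * r * ln r)"

lemma parabola_bound:
  fixes A L k :: real
  assumes "A > 0"
  shows "2 * k * (L - k * A) \<le> L ^ 2 / (2 * A)"
proof -
  have "0 \<le> (L - 2 * k * A) ^ 2" by simp
  then have "4 * k * A * (L - k * A) \<le> L ^ 2" by (simp add: power2_eq_square algebra_simps)
  then show ?thesis using assms by (simp add: field_simps)
qed

text \<open>
  The number of codewords at level \<open>k\<close>. For \<open>k < r powr \<beta>\<close> the exponent \<open>2 * (k + m + 1)\<close> is
  \<open>O(r powr \<beta>)\<close> with \<open>\<beta> < 1/2\<close>, so the trivial bound \<open>exp b\<close> on the probability suffices. For larger \<open>k\<close>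
  both \<open>ln k\<close> and \<open>ln m\<close> are at least \<open>\<beta> * ln r\<close>, and the parabola bound applies with a slope \<open>A\<close>
  that has absorbed all constants.
\<close>

lemma level_cost:
  fixes b \<alpha> \<eta> r L q :: real and m k :: nat
  defines "\<beta> \<equiv> 1 / 2 - \<eta> / 8"
  assumes pos: "b > 0" "\<alpha> > 0" "0 < \<eta>" "\<eta> < 1" "r > 1"
    and m: "r powr \<beta> \<le> real m" "real m \<le> r powr \<beta> + 1"
    and q: "q = b * (1 / real m) powr \<alpha>"
    and k: "real k \<le> sqrt r + 1"
    and L: "L = (1 - \<eta>) * rate \<alpha> r"
    and r_large: "1 + ln b \<le> (1 + \<alpha>) * (\<eta> / 8) * ln r"
  shows "(2 + q ^ k / fact k * exp L) ^ (2 * (k + m + 1))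
    \<le> exp ((1 - \<eta>) * r + 4 * (sqrt r + 1) + 4 * (r powr \<beta> + 2) * (b + 2 + L))"
proof -
  have s: "ln r > 0" using pos by simp
  have L0: "L \<ge> 0" using pos by (simp add: L rate_def)
  have \<beta>: "\<beta> > 0" using pos by (simp add: \<beta>_def)
  have m1: "m \<ge> 1"
  proof -
    have "0 < r powr \<beta>" using pos by simp
    with m(1) have "0 < real m" by linarith
    then show ?thesis by simp
  qed
  have q_nonneg: "q \<ge> 0" using pos by (simp add: q)
  have q_le_b: "q \<le> b"
  proof -
    have "(1 / real m) powr \<alpha> \<le> 1 powr \<alpha>" using m1 pos by (intro powr_mono2) auto
    then show ?thesis using pos by (simp add: q)
  qed
  have three: "(3::real) \<le> exp 2" using exp_ge_add_one_self[of 2] by simp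
  define X where "X = (1 - \<eta>) * r + 4 * (sqrt r + 1) + 4 * (r powr \<beta> + 2) * (b + 2 + L)"
  have power_le: "(2 + q ^ k / fact k * exp L) ^ (2 * (k + m + 1)) \<le> exp X"
    if "2 + q ^ k / fact k * exp L \<le> exp t" "2 * (real k + real m + 1) * t \<le> X" for t
  proof -
    have "(2 + q ^ k / fact k * exp L) ^ (2 * (k + m + 1)) \<le> exp t ^ (2 * (k + m + 1))"
      using that q_nonneg by (intro power_mono) auto
    also have "\<dots> = exp (2 * (real k + real m + 1) * t)"
      by (simp only: exp_of_nat_mult[symmetric] of_nat_mult of_nat_add of_nat_numeral of_nat_1)
    finally show ?thesis using that(2) by (meson exp_le_cancel_iff order_trans)
  qed
  have "(2 + q ^ k / fact k * exp L) ^ (2 * (k + m + 1)) \<le> exp X"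
  proof (cases "real k < r powr \<beta>")
    case True
    have "q ^ k / fact k \<le> exp b"
      using power_mono[OF q_le_b q_nonneg, of k] power_div_fact_le_exp[of b k] pos
      by (meson divide_right_mono fact_ge_zero less_imp_le order_trans)
    then have "2 + q ^ k / fact k * exp L \<le> 2 + exp b * exp L"
      by (intro add_left_mono mult_right_mono) auto
    also have "\<dots> \<le> 3 * exp (b + L)" using pos L0 by (simp add: exp_add[symmetric])
    also have "\<dots> \<le> exp 2 * exp (b + L)" using three by (intro mult_right_mono) auto
    also have "\<dots> = exp (b + 2 + L)" by (simp add: exp_add)
    finally have *: "2 + q ^ k / fact k * exp L \<le> exp (b + 2 + L)" .
    have "2 * (real k + real m + 1) * (b + 2 + L) \<le> (4 * (r powr \<beta> + 2)) * (b + 2 + L)"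
      using True m pos L0 by (intro mult_right_mono) auto
    also have "\<dots> \<le> X" using pos by (simp add: X_def)
    finally show ?thesis using power_le[OF *] by simp
  next
    case False
    \<comment> \<open>Half of the slack \<open>\<eta>/4\<close> is in \<open>\<beta>\<close>; the other half pays for the constant \<open>1 + ln b\<close>.\<close>
    define A where "A = (1 + \<alpha>) * (\<beta> - \<eta> / 8) * ln r"
    have A: "A > 0" using pos s by (simp add: A_def \<beta>_def)
    define y where "y = L - real k * A"
    have "q ^ k / fact k \<le> (q * exp 1 / r powr \<beta>) ^ k"
      using q_nonneg pos False by (intro tail_term_le) auto
    also have "\<dots> \<le> (exp (- A)) ^ k"
    proof (rule power_mono)
      have "q \<le> b * (r powr (- \<beta>)) powr \<alpha>"
        unfolding q using m pos m1
        by (intro mult_left_mono powr_mono2) (auto simp: powr_minus field_simps)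
      also have "\<dots> = exp (ln b - \<alpha> * \<beta> * ln r)"
      proof -
        have "(r powr (- \<beta>)) powr \<alpha> = exp (- (\<alpha> * \<beta> * ln r))"
          unfolding powr_powr using pos by (simp add: powr_def mult_ac)
        then show ?thesis using pos by (simp add: exp_diff exp_minus divide_inverse)
      qed
      finally have "q * exp 1 / r powr \<beta> \<le> exp (ln b - \<alpha> * \<beta> * ln r) * exp 1 / r powr \<beta>"
        by (intro divide_right_mono mult_right_mono) auto
      also have "\<dots> = exp (1 + ln b - (1 + \<alpha>) * \<beta> * ln r)"
        using pos by (simp add: powr_def exp_diff exp_add algebra_simps)
      also have "\<dots> \<le> exp (- A)"
        using r_large by (simp add: A_def algebra_simps)
      finally show "q * exp 1 / r powr \<beta> \<le> exp (- A)" .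
    qed (use q_nonneg in auto)
    also have "\<dots> = exp (- (real k * A))" by (simp flip: exp_of_nat_mult)
    finally have "q ^ k / fact k * exp L \<le> exp (- (real k * A)) * exp L"
      by (rule mult_right_mono) simp
    also have "\<dots> = exp y" by (simp add: y_def exp_diff exp_minus field_simps)
    also have "\<dots> \<le> exp (max 0 y)" by simp
    finally have "2 + q ^ k / fact k * exp L \<le> 3 * exp (max 0 y)"
      using one_le_exp_iff[of "max 0 y"] by linarith
    also have "\<dots> \<le> exp 2 * exp (max 0 y)" using three by (intro mult_right_mono) auto
    also have "\<dots> = exp (2 + max 0 y)" by (simp add: exp_add)
    finally have *: "2 + q ^ k / fact k * exp L \<le> exp (2 + max 0 y)" .
    have "2 * real k * y \<le> L ^ 2 / (2 * A)" unfolding y_def by (rule parabola_bound[OF A])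
    also have "\<dots> = (1 - \<eta>) ^ 2 * r / (1 - \<eta> / 2)"
    proof -
      have "L ^ 2 = (1 - \<eta>) ^ 2 * r * ((1 + \<alpha>) * ln r)"
        using pos s by (simp add: L rate_def power_mult_distrib)
      moreover have "2 * A = (1 - \<eta> / 2) * ((1 + \<alpha>) * ln r)"
        by (simp add: A_def \<beta>_def field_simps)
      moreover have "(1 + \<alpha>) * ln r \<noteq> 0" using pos s by simp
      ultimately show ?thesis by (metis nonzero_mult_divide_mult_cancel_right)
    qed
    also have "\<dots> \<le> (1 - \<eta>) * r"
    proof -
      have "(1 - \<eta>) ^ 2 * r \<le> (1 - \<eta>) * r * (1 - \<eta> / 2)"
        using pos by (simp add: power2_eq_square mult.assoc mult_left_mono)
      then show ?thesis using pos by (simp add: divide_le_eq)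
    qed
    finally have y1: "2 * real k * max 0 y \<le> (1 - \<eta>) * r"
      using pos by (auto simp: max_def)
    have "max 0 y \<le> L" using A L0 by (simp add: y_def)
    then have large: "2 * (real m + 1) * (2 + max 0 y) \<le> 4 * (r powr \<beta> + 2) * (b + 2 + L)"
      using m pos L0 by (intro mult_mono) auto
    have "4 * real k \<le> 4 * (sqrt r + 1)" using k by simp
    have "2 * (real k + real m + 1) * (2 + max 0 y)
        = 2 * real k * max 0 y + 4 * real k + 2 * (real m + 1) * (2 + max 0 y)"
      by (simp only: distrib_left distrib_right mult.assoc)
    also have "\<dots> \<le> X"
      unfolding X_def by (intro add_mono) fact+
    finally have "2 * (real k + real m + 1) * (2 + max 0 y) \<le> X" .
    then show ?thesis using power_le[OF *] by simp
  qed
  then show ?thesis by (simp add: X_def)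
qed

lemma eventually_parameters:
  fixes b \<alpha> \<eta> :: real
  assumes pos: "b > 0" "\<alpha> > 0" "0 < \<eta>" "\<eta> < 1"
  shows "\<forall>\<^sub>F r in at_top. \<exists>m n g q. m > 0 \<and> (\<forall>k. g k > 0) \<and> q = b * (1 / real m) powr \<alpha>
    \<and> 2 + (\<Sum>k\<le>n. real (g k + 1) ^ (2 * (k + m + 1))) \<le> exp r
    \<and> (\<Sum>k\<le>n. q ^ k / fact k / real (g k)) + q ^ Suc n / fact (Suc n)
        \<le> exp (- ((1 - 2 * \<eta>) * rate \<alpha> r))"
proof -
  define \<beta> where "\<beta> = 1 / 2 - \<eta> / 8"
  have \<beta>: "0 < \<beta>" "\<beta> < 1 / 2" using pos by (auto simp: \<beta>_def)
  have "\<forall>\<^sub>F r in at_top. r > (1::real)" by (rule eventually_gt_at_top)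
  moreover have "\<forall>\<^sub>F r in at_top. 1 + ln b \<le> (1 + \<alpha>) * (\<eta> / 8) * ln r"
    using pos by real_asymp
  moreover have "\<forall>\<^sub>F r in at_top. ln (sqrt r + 4) + 4 * (sqrt r + 1)
      + 4 * (r powr \<beta> + 2) * (b + 2 + (1 - \<eta>) * rate \<alpha> r) \<le> \<eta> * r"
    unfolding rate_def using pos \<beta> by real_asymp
  moreover have "\<forall>\<^sub>F r in at_top. b * exp 1 \<le> sqrt r"
    by real_asymp
  moreover have "\<forall>\<^sub>F r in at_top. rate \<alpha> r \<le> sqrt r * (ln r / 2 - (1 + ln b))"
    unfolding rate_def using pos by real_asymp
  moreover have "\<forall>\<^sub>F r in at_top. ln (sqrt r + 3) \<le> \<eta> * rate \<alpha> r"
    unfolding rate_def using pos by real_asymp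
  ultimately show ?thesis
  proof eventually_elim
    case (elim r)
    note r1 = elim(1) and total = elim(3) and sqrt_large = elim(4) and tail = elim(5) and error = elim(6)
    define L where "L = (1 - \<eta>) * rate \<alpha> r"
    define m where "m = nat \<lceil>r powr \<beta>\<rceil>"
    define n where "n = nat \<lceil>sqrt r\<rceil>"
    define q where "q = b * (1 / real m) powr \<alpha>"
    define p where "p k = q ^ k / fact k" for k
    \<comment> \<open>The summand \<open>1\<close> keeps the mesh finite at levels so unlikely that they need no resolution.\<close>
    define g where "g k = 1 + nat \<lfloor>p k * exp L\<rfloor>" for k
    have "r powr \<beta> > 0" using r1 by simp
    then have m: "r powr \<beta> \<le> real m" "real m \<le> r powr \<beta> + 1" and "m > 0"
      unfolding m_def by linarith+
    have "sqrt r > 0" using r1 by simp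
    then have n: "sqrt r \<le> real n" "real n \<le> sqrt r + 1" unfolding n_def by linarith+
    have rate0: "rate \<alpha> r \<ge> 0" using pos r1 by (simp add: rate_def)
    have q0: "q \<ge> 0" using pos by (simp add: q_def)
    then have p0: "p k \<ge> 0" for k by (simp add: p_def)
    have q_le_b: "q \<le> b"
    proof -
      have "(1 / real m) powr \<alpha> \<le> 1 powr \<alpha>" using \<open>m > 0\<close> pos by (intro powr_mono2) auto
      then show ?thesis using pos by (simp add: q_def)
    qed
    have g_ge: "p k * exp L \<le> real (g k)" and g_le: "real (g k + 1) \<le> 2 + p k * exp L" for k
    proof -
      have "p k * exp L \<ge> 0" using p0 by simp
      then show "p k * exp L \<le> real (g k)" "real (g k + 1) \<le> 2 + p k * exp L"
        unfolding g_def by linarith+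
    qed
    define X where "X = (1 - \<eta>) * r + 4 * (sqrt r + 1) + 4 * (r powr \<beta> + 2) * (b + 2 + L)"
    have "real (g k + 1) ^ (2 * (k + m + 1)) \<le> exp X" if "k \<le> n" for k
    proof -
      have "real (g k + 1) ^ (2 * (k + m + 1)) \<le> (2 + p k * exp L) ^ (2 * (k + m + 1))"
        by (intro power_mono g_le) simp
      also have "\<dots> \<le> exp X"
        unfolding p_def X_def \<beta>_def
        using pos r1 m that n elim(2) by (intro level_cost) (auto simp: \<beta>_def q_def L_def)
      finally show ?thesis .
    qed
    then have "(\<Sum>k\<le>n. real (g k + 1) ^ (2 * (k + m + 1))) \<le> real (card {..n}) * exp X"
      by (intro sum_bounded_above) auto
    also have "\<dots> \<le> (sqrt r + 2) * exp X" using n by (intro mult_right_mono) auto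
    finally have "2 + (\<Sum>k\<le>n. real (g k + 1) ^ (2 * (k + m + 1))) \<le> 2 * 1 + (sqrt r + 2) * exp X"
      by simp
    also have "\<dots> \<le> 2 * exp X + (sqrt r + 2) * exp X"
    proof -
      have "X \<ge> 0" unfolding X_def L_def using pos r1 rate0 by (intro add_nonneg_nonneg mult_nonneg_nonneg) auto
      then show ?thesis by simp
    qed
    also have "\<dots> = exp (ln (sqrt r + 4) + X)"
    proof -
      have "exp (ln (sqrt r + 4)) = sqrt r + 4" using \<open>sqrt r > 0\<close> by (intro exp_ln) linarith
      then show ?thesis by (simp add: exp_add algebra_simps)
    qed
    also have "\<dots> \<le> exp r"
      using total by (simp add: X_def L_def algebra_simps)
    finally have size: "2 + (\<Sum>k\<le>n. real (g k + 1) ^ (2 * (k + m + 1))) \<le> exp r" .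
    \<comment> \<open>Every coded level contributes at most \<open>exp (- L)\<close> to the mean error, by the choice of \<open>g\<close>.\<close>
    have "p k / real (g k) \<le> exp (- L)" for k
      using g_ge[of k] by (simp add: g_def exp_minus field_simps)
    then have "(\<Sum>k\<le>n. p k / real (g k)) \<le> real (card {..n}) * exp (- L)"
      by (intro sum_bounded_above) auto
    moreover have "p (Suc n) \<le> exp (- L)"
    proof -
      have "p (Suc n) \<le> b ^ Suc n / fact (Suc n)"
        unfolding p_def using q_le_b q0 by (intro divide_right_mono power_mono) auto
      also have "\<dots> \<le> (b * exp 1 / sqrt r) ^ Suc n"
        using pos n \<open>sqrt r > 0\<close> by (intro tail_term_le) auto
      also have "\<dots> = (b * exp 1 / sqrt r) powr real (Suc n)"
        using pos \<open>sqrt r > 0\<close> by (intro powr_realpow[symmetric]) auto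
      also have "\<dots> \<le> (b * exp 1 / sqrt r) powr sqrt r"
        using pos n \<open>sqrt r > 0\<close> sqrt_large by (intro powr_mono') auto
      also have "\<dots> = exp (- (sqrt r * (ln r / 2 - (1 + ln b))))"
        using pos r1 \<open>sqrt r > 0\<close> by (simp add: powr_def ln_div ln_mult ln_sqrt algebra_simps)
      also have "\<dots> \<le> exp (- L)"
      proof -
        have "L \<le> rate \<alpha> r" using rate0 pos by (simp add: L_def mult_left_le_one_le)
        then show ?thesis using tail by simp
      qed
      finally show ?thesis .
    qed
    ultimately have "(\<Sum>k\<le>n. p k / real (g k)) + p (Suc n) \<le> (real n + 2) * exp (- L)"
      by (simp add: algebra_simps)
    also have "\<dots> \<le> (sqrt r + 3) * exp (- L)" using n by (intro mult_right_mono) auto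
    also have "\<dots> = exp (ln (sqrt r + 3) - L)"
    proof -
      have "exp (ln (sqrt r + 3)) = sqrt r + 3" using \<open>sqrt r > 0\<close> by (intro exp_ln) linarith
      then show ?thesis by (simp add: exp_diff exp_minus field_simps)
    qed
    also have "\<dots> \<le> exp (- ((1 - 2 * \<eta>) * rate \<alpha> r))"
      using error by (simp add: L_def algebra_simps)
    finally show ?case
      using size \<open>m > 0\<close>
      by (intro exI[of _ m] exI[of _ n] exI[of _ g] exI[of _ q]) (auto simp: q_def p_def g_def)
  qed
qed

text \<open>
  Near zero the bound is the integral of the density; away from zero it holds because
  probabilities are at most one, once \<open>C\<close> is large enough.
\<close>

lemma (in prob_space) prob_le_powr_of_density:
  fixes X :: "'a \<Rightarrow> real" and p :: "real \<Rightarrow> real"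
  assumes X: "distributed M lborel X (\<lambda>z. ennreal (p z) * indicator {0<..} z)"
    and "c > 0" "\<alpha> > 0" and p: "\<forall>\<^sub>F z in at_right 0. p z \<le> c * z powr (\<alpha> - 1)"
  shows "\<exists>C>0. \<forall>x>0. prob {\<omega> \<in> space M. X \<omega> \<le> x} \<le> C * x powr \<alpha>"
proof -
  obtain x0 where x0: "x0 > 0" "\<And>z. 0 < z \<Longrightarrow> z < x0 \<Longrightarrow> p z \<le> c * z powr (\<alpha> - 1)"
    using p unfolding eventually_at_right_field by blast
  define C where "C = max (c / \<alpha>) (1 / x0 powr \<alpha>)"
  have "prob {\<omega> \<in> space M. X \<omega> \<le> x} \<le> C * x powr \<alpha>" if "x > 0" for x
  proof (cases "x < x0")
    case True
    have "((\<lambda>z. c * z powr (\<alpha> - 1)) has_integral c * (x powr (\<alpha> - 1 + 1) / (\<alpha> - 1 + 1))) {0..x}"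
      using assms that by (intro has_integral_mult_right has_integral_powr_from_0) auto
    then have int: "(\<integral>\<^sup>+z. ennreal (c * z powr (\<alpha> - 1)) * indicator {0..x} z \<partial>lborel)
        = ennreal (c / \<alpha> * x powr \<alpha>)"
      using \<open>c > 0\<close> by (subst nn_integral_has_integral_lebesgue') auto
    have "X -` {..x} \<inter> space M = {\<omega> \<in> space M. X \<omega> \<le> x}" by auto
    then have "emeasure M {\<omega> \<in> space M. X \<omega> \<le> x}
        = (\<integral>\<^sup>+z. ennreal (p z) * indicator {0<..} z * indicator {..x} z \<partial>lborel)"
      using distributed_emeasure[OF X, of "{..x}"] by simp
    also have "\<dots> \<le> (\<integral>\<^sup>+z. ennreal (c * z powr (\<alpha> - 1)) * indicator {0..x} z \<partial>lborel)"
      using x0 True by (intro nn_integral_mono) (auto simp: indicator_def intro!: ennreal_leI)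
    finally have "prob {\<omega> \<in> space M. X \<omega> \<le> x} \<le> c / \<alpha> * x powr \<alpha>"
      unfolding int emeasure_eq_measure using assms by (subst (asm) ennreal_le_iff) auto
    also have "\<dots> \<le> C * x powr \<alpha>" by (intro mult_right_mono) (auto simp: C_def)
    finally show ?thesis .
  next
    case False
    have "prob {\<omega> \<in> space M. X \<omega> \<le> x} \<le> 1" by simp
    also have "\<dots> \<le> 1 / x0 powr \<alpha> * x powr \<alpha>"
      using False x0 \<open>\<alpha> > 0\<close> by (simp add: powr_mono2)
    also have "\<dots> \<le> C * x powr \<alpha>" by (intro mult_right_mono) (auto simp: C_def)
    finally show ?thesis .
  qed
  moreover have "C > 0" using assms by (simp add: C_def less_max_iff_disj)
  ultimately show ?thesis by blast
qed

section \<open>The upper bound\<close>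

text \<open>
  The best possible error term is read off from \<open>D\<close> itself. It is capped at zero from above, so that
  only lower bounds on it are needed, and those are what the hypothesis provides for every \<open>\<eta>\<close>.
\<close>

lemma exp_bound_with_vanishing_error:
  fixes D :: "real \<Rightarrow> ennreal" and h :: "real \<Rightarrow> real"
  assumes h: "\<forall>\<^sub>F r in at_top. h r > 0"
    and D: "\<And>\<eta>. 0 < \<eta> \<Longrightarrow> \<eta> < 1 \<Longrightarrow> \<forall>\<^sub>F r in at_top. D r \<le> ennreal (exp (- ((1 - \<eta>) * h r)))"
  shows "\<exists>\<epsilon> :: real \<Rightarrow> real. (\<epsilon> \<longlongrightarrow> 0) at_top \<and>
    (\<forall>\<^sub>F r in at_top. D r \<le> ennreal (exp (- (h r * (1 + \<epsilon> r)))))"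
proof -
  define \<epsilon> where "\<epsilon> r = (if D r = 0 then 0 else min 0 (- ln (enn2real (D r)) / h r - 1))" for r
  have "(\<epsilon> \<longlongrightarrow> 0) at_top"
  proof (rule tendstoI)
    fix e :: real assume "e > 0"
    define \<eta> where "\<eta> = min (e / 2) (1 / 2)"
    have \<eta>: "0 < \<eta>" "\<eta> < 1" "\<eta> < e" using \<open>e > 0\<close> by (auto simp: \<eta>_def)
    show "\<forall>\<^sub>F r in at_top. dist (\<epsilon> r) 0 < e"
      using D[OF \<eta>(1,2)] h
    proof eventually_elim
      case (elim r)
      show ?case
      proof (cases "D r = 0")
        case False
        have fin: "D r < \<infinity>" using elim(1) by (metis ennreal_less_top infinity_ennreal_def le_less_trans)
        then have "enn2real (D r) > 0" using False by (simp add: enn2real_positive_iff zero_less_iff_neq_zero)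
        moreover have "enn2real (D r) \<le> exp (- ((1 - \<eta>) * h r))"
          using elim(1) by (simp add: enn2real_leI)
        ultimately have "ln (enn2real (D r)) \<le> ln (exp (- ((1 - \<eta>) * h r)))"
          by (subst ln_le_cancel_iff) auto
        then have "ln (enn2real (D r)) \<le> - ((1 - \<eta>) * h r)" by simp
        then have "(1 - \<eta>) \<le> - ln (enn2real (D r)) / h r"
          using elim(2) by (subst pos_le_divide_eq) auto
        then show ?thesis using \<eta> by (auto simp: \<epsilon>_def False dist_real_def)
      qed (use \<open>e > 0\<close> in \<open>simp add: \<epsilon>_def\<close>)
    qed
  qed
  moreover have "\<forall>\<^sub>F r in at_top. D r \<le> ennreal (exp (- (h r * (1 + \<epsilon> r))))"
    using D[of "1 / 2", simplified] h
  proof eventually_elim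
    case (elim r)
    show ?case
    proof (cases "D r = 0")
      case False
      have fin: "D r < \<infinity>" using elim(1) by (metis ennreal_less_top infinity_ennreal_def le_less_trans)
      then have pos: "enn2real (D r) > 0" using False by (simp add: enn2real_positive_iff zero_less_iff_neq_zero)
      have "1 + \<epsilon> r \<le> - ln (enn2real (D r)) / h r" by (simp add: \<epsilon>_def False)
      then have "h r * (1 + \<epsilon> r) \<le> - ln (enn2real (D r))" 
        using elim(2) by (subst (asm) pos_le_divide_eq) (auto simp: mult.commute)
      then have "exp (ln (enn2real (D r))) \<le> exp (- (h r * (1 + \<epsilon> r)))" by simp
      then have "enn2real (D r) \<le> exp (- (h r * (1 + \<epsilon> r)))" using pos by simp
      then show ?thesis using fin by (metis ennreal_enn2real ennreal_leI infinity_ennreal_def)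
    qed simp
  qed
  ultimately show ?thesis by blast
qed

theorem corollary5:
  fixes M :: "'a measure"
    and \<xi> R :: "nat \<Rightarrow> 'a \<Rightarrow> real"
    and N :: "'a \<Rightarrow> nat"
    and lam c \<alpha> :: real
    and p :: "real \<Rightarrow> real"
  assumes "boolean_model M \<xi> R N lam"
    and "\<And>z. z > 0 \<Longrightarrow> p z \<ge> 0"
    and "distributed M lborel (R 0) (\<lambda>z. ennreal (p z) * indicator {0<..} z)"
    and "c > 0" and "\<alpha> > 0"
    and "\<forall>\<^sub>F z in at_right 0. p z \<le> c * z powr (\<alpha> - 1)"
  shows "\<exists>\<epsilon> :: real \<Rightarrow> real. (\<epsilon> \<longlongrightarrow> 0) at_top \<and>
    (\<forall>\<^sub>F r in at_top. quantization_error M (boolean_set \<xi> R N) r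
       \<le> ennreal (exp (- (sqrt ((1 + \<alpha>) * r * ln r) * (1 + \<epsilon> r)))))"
proof -
  interpret boolean_model M \<xi> R N lam by fact
  obtain C where C: "C > 0" "\<And>x. x > 0 \<Longrightarrow> prob {\<omega> \<in> space M. R 0 \<omega> \<le> x} \<le> C * x powr \<alpha>"
    using prob_le_powr_of_density[OF assms(3-6)] by blast
  have "\<forall>\<^sub>F r in at_top. quantization_error M (boolean_set \<xi> R N) r
      \<le> ennreal (exp (- ((1 - \<eta>) * rate \<alpha> r)))" if "0 < \<eta>" "\<eta> < 1" for \<eta>
  proof -
    have "lam * C > 0" "0 < \<eta> / 2" "\<eta> / 2 < 1" using C lam_pos that by auto
    from eventually_parameters[OF this(1) \<open>\<alpha> > 0\<close> this(2,3)] show ?thesis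
    proof eventually_elim
      case (elim r)
      then obtain m n g q where m: "m > 0" and g: "\<And>k. g k > 0"
        and q: "q = lam * C * (1 / real m) powr \<alpha>"
        and size: "2 + (\<Sum>k\<le>n. real (g k + 1) ^ (2 * (k + m + 1))) \<le> exp r"
        and err: "(\<Sum>k\<le>n. q ^ k / fact k / real (g k)) + q ^ Suc n / fact (Suc n)
          \<le> exp (- ((1 - 2 * (\<eta> / 2)) * rate \<alpha> r))"
        by blast
      have "prob {\<omega> \<in> space M. R 0 \<omega> \<le> 1 / real m} \<le> C * (1 / real m) powr \<alpha>"
        using m by (intro C) simp
      from quantization_error_le[OF m g this size]
      have "quantization_error M (boolean_set \<xi> R N) r
        \<le> ennreal ((\<Sum>k\<le>n. q ^ k / fact k / real (g k)) + q ^ Suc n / fact (Suc n))"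
        unfolding q by (simp only: mult.assoc)
      also have "\<dots> \<le> ennreal (exp (- ((1 - \<eta>) * rate \<alpha> r)))"
        using err by (intro ennreal_leI) simp
      finally show ?case .
    qed
  qed
  moreover have "\<forall>\<^sub>F r in at_top. rate \<alpha> r > 0"
    unfolding rate_def using \<open>\<alpha> > 0\<close> by real_asymp
  ultimately show ?thesis
    unfolding rate_def[symmetric] by (intro exp_bound_with_vanishing_error) auto
qed

end
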